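(* Let $(\bar N,g)$ be an $n$-dimensional Riemannian manifold isometrically embedded in $\mathbb{R}^S$, $N\subset\bar N$ compact, $1\le m\le n-1$. If $N$ contains no non-zero $m$-varifold with null weak mean curvature relative to $\bar N$, then $N$ contains no non-zero $m$-varifold with null generalized second fundamental form.
   Context: $G(S,m)$ is the Grassmannian of $m$-planes in $\mathbb{R}^S$, each $P$ identified with its orthogonal projection matrix $(P_{ij})$; $Q(x)=(Q_{ij}(x))$ is the orthogonal projection onto $T_x\bar N$; $G_m(N)=\{(x,P):x\in N,\ P\subset T_x\bar N\}$. An $m$-varifold on $N$ is any Radon measure $V$ on $G_m(N)$. Generalized curvature $B=(B_{ijk})\in L^1_{loc}(V)$: for all $\phi\in C^1_c(\mathbb{R}^S\times\mathbb{R}^{S\times S})$ and each $i$, $0=\int[P_{ij}D_j\phi+B_{ijk}D^*_{jk}\phi+B_{jij}\phi]\,dV$ (summation convention; $D_j=\partial/\partial x_j$, $D^*_{jk}=\partial/\partial P_{jk}$); generalized second fundamental form $A^k_{ij}=P_{lj}B_{ikl}-P_{lj}P_{iq}\partial_{x_q}Q_{kl}(x)$. Weak mean curvature in $\mathbb{R}^S$: $\mathbb{R}^S$-valued $H\in L^1_{loc}(V)$ with $\int\operatorname{div}_PX\,dV=-\int H\cdot X\,dV$ for all $X\in C^1_c(\mathbb{R}^S;\mathbb{R}^S)$, $\operatorname{div}_PX=\sum P_{ij}\partial_jX^i$. $V$ has weak mean curvature $H^N$ relative to $\bar N$ if as a varifold in $\mathbb{R}^S$ it has weak mean curvature $H^{\mathbb{R}^S}$;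 then $(H^N)_i=(H^{\mathbb{R}^S})_i-\sum_{j,k}P_{jk}\partial_{x_k}Q_{ij}(x)$. *)

theory Defs
  imports "HOL-Analysis.Analysis"
begin

section \<open>Smoothness (C-infinity) via iterated directional derivatives\<close>

fun iter_dd :: "'a list \<Rightarrow> ('a::real_normed_vector \<Rightarrow> 'b::real_normed_vector) \<Rightarrow> 'a \<Rightarrow> 'b" where
  "iter_dd [] f = f"
| "iter_dd (v # vs) f = (\<lambda>x. frechet_derivative (iter_dd vs f) (at x) v)"

text \<open>f is C-infinity on the open set U: all iterated directional derivatives
  exist and are differentiable at every point of U.\<close>
definition smooth_on :: "'a::real_normed_vector set \<Rightarrow> ('a \<Rightarrow> 'b::real_normed_vector) \<Rightarrow> bool" where
  "smooth_on U f \<longleftrightarrow> (\<forall>vs. \<forall>x\<in>U. iter_dd vs f differentiable (at x))"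

section \<open>Embedded submanifolds of R^S\<close>

text \<open>A local chart (parametrization) of Nbar: a smooth immersion of an open subset
  U of R^n that is a homeomorphism onto the relatively open piece Nbar \<inter> W.\<close>
definition chart :: "(real^'s) set \<Rightarrow> (real^'n) set \<Rightarrow> (real^'s) set \<Rightarrow> (real^'n \<Rightarrow> real^'s) \<Rightarrow> bool" where
  "chart Nbar U W \<phi> \<longleftrightarrow> open U \<and> open W \<and> smooth_on U \<phi> \<and> \<phi> ` U = Nbar \<inter> W \<and>
     inj_on \<phi> U \<and> continuous_on (Nbar \<inter> W) (inv_into U \<phi>) \<and>
     (\<forall>u\<in>U. inj (frechet_derivative \<phi> (at u)))"

text \<open>Nbar is an n-dimensional smooth embedded submanifold of R^S, n = CARD('n).
  (An isometrically embedded Riemannian manifold carries the induced metric, so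
  only the embedded submanifold matters.)\<close>
definition embedded_submanifold :: "('n::finite) itself \<Rightarrow> (real^'s) set \<Rightarrow> bool" where
  "embedded_submanifold TYPE('n) Nbar \<longleftrightarrow>
     (\<forall>p\<in>Nbar. \<exists>U W (\<phi>::real^'n \<Rightarrow> real^'s). chart Nbar U W \<phi> \<and> p \<in> W)"

definition tangent_space :: "('n::finite) itself \<Rightarrow> (real^'s) set \<Rightarrow> real^'s \<Rightarrow> (real^'s) set" where
  "tangent_space TYPE('n) Nbar x =
     {v. \<exists>U W (\<phi>::real^'n \<Rightarrow> real^'s) u. chart Nbar U W \<phi> \<and> u \<in> U \<and> \<phi> u = x \<and>
          v \<in> range (frechet_derivative \<phi> (at u))}"

text \<open>Q x is the orthogonal projection (matrix) onto T_x Nbar for x in Nbar, and Q is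
  smooth on an open neighbourhood of Nbar (so that its partial derivatives make sense).\<close>
definition tangent_projection :: "('n::finite) itself \<Rightarrow> (real^'s) set \<Rightarrow> (real^'s \<Rightarrow> real^'s^'s) \<Rightarrow> bool" where
  "tangent_projection TYPE('n) Nbar Q \<longleftrightarrow>
     (\<exists>Om. open Om \<and> Nbar \<subseteq> Om \<and> smooth_on Om Q) \<and>
     (\<forall>x\<in>Nbar. transpose (Q x) = Q x \<and> Q x ** Q x = Q x \<and>
                range ((*v) (Q x)) = tangent_space TYPE('n) Nbar x)"

section \<open>Grassmannian, G_m(N), varifolds\<close>

text \<open>G(S,m): m-planes identified with their orthogonal projection matrices.\<close>
definition grassmannian :: "nat \<Rightarrow> (real^'s^'s) set" where
  "grassmannian m = {P. transpose P = P \<and> P ** P = P \<and> rank P = m}"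

text \<open>G_m(N) = {(x,P). x \<in> N, P \<subseteq> T_x Nbar}; P \<subseteq> T_x Nbar iff Q(x) P = P.\<close>
definition Gm :: "nat \<Rightarrow> (real^'s) set \<Rightarrow> (real^'s \<Rightarrow> real^'s^'s) \<Rightarrow> ((real^'s) \<times> (real^'s^'s)) set" where
  "Gm m N Q = {(x, P). x \<in> N \<and> P \<in> grassmannian m \<and> Q x ** P = P}"

text \<open>An m-varifold on N: a Radon measure on G_m(N), i.e. a Borel measure on
  R^S x R^(SxS), finite on compact sets, concentrated on G_m(N).\<close>
definition varifold :: "nat \<Rightarrow> (real^'s) set \<Rightarrow> (real^'s \<Rightarrow> real^'s^'s) \<Rightarrow> ((real^'s) \<times> (real^'s^'s)) measure \<Rightarrow> bool" where
  "varifold m N Q V \<longleftrightarrow> sets V = sets borel \<and> (\<forall>K. compact K \<longrightarrow> emeasure V K < \<infinity>) \<and>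
     (AE z in V. z \<in> Gm m N Q)"

definition nonzero_measure :: "'a measure \<Rightarrow> bool" where
  "nonzero_measure V \<longleftrightarrow> emeasure V (space V) \<noteq> 0"

definition loc_integrable :: "('a::topological_space) measure \<Rightarrow> ('a \<Rightarrow> 'b::{banach,second_countable_topology}) \<Rightarrow> bool" where
  "loc_integrable V f \<longleftrightarrow> (\<forall>K. compact K \<longrightarrow> set_integrable V K f)"

text \<open>C^1 functions with compact support.\<close>
definition C1c :: "('a::euclidean_space \<Rightarrow> 'b::euclidean_space) \<Rightarrow> bool" where
  "C1c f \<longleftrightarrow> (\<exists>f'. (\<forall>x. (f has_derivative blinfun_apply (f' x)) (at x)) \<and> continuous_on UNIV f') \<and>
     compact (closure {x. f x \<noteq> 0})"

section \<open>Partial derivatives\<close>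

text \<open>D_j = d/dx_j and D*_jk = d/dP_jk for functions on R^S x R^(SxS).\<close>
definition Dx :: "((real^'s) \<times> (real^'s^'s) \<Rightarrow> real) \<Rightarrow> 's \<Rightarrow> (real^'s) \<times> (real^'s^'s) \<Rightarrow> real" where
  "Dx \<phi> j z = frechet_derivative \<phi> (at z) (axis j 1, 0)"

definition DP :: "((real^'s) \<times> (real^'s^'s) \<Rightarrow> real) \<Rightarrow> 's \<Rightarrow> 's \<Rightarrow> (real^'s) \<times> (real^'s^'s) \<Rightarrow> real" where
  "DP \<phi> j k z = frechet_derivative \<phi> (at z) (0, axis j (axis k 1))"

text \<open>dQ Q q x k l = partial derivative of Q_kl w.r.t. x_q at x.\<close>
definition dQ :: "(real^'s \<Rightarrow> real^'s^'s) \<Rightarrow> 's \<Rightarrow> real^'s \<Rightarrow> 's \<Rightarrow> 's \<Rightarrow> real" where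
  "dQ Q q x k l = (frechet_derivative Q (at x) (axis q 1)) $ k $ l"

definition divP :: "real^'s^'s \<Rightarrow> (real^'s \<Rightarrow> real^'s) \<Rightarrow> real^'s \<Rightarrow> real" where
  "divP P X x = (\<Sum>i\<in>UNIV. \<Sum>j\<in>UNIV. P $ i $ j * (frechet_derivative X (at x) (axis j 1)) $ i)"

section \<open>Generalized curvature and second fundamental form\<close>

definition generalized_curvature ::
  "((real^'s) \<times> (real^'s^'s)) measure \<Rightarrow> ((real^'s) \<times> (real^'s^'s) \<Rightarrow> 's \<Rightarrow> 's \<Rightarrow> 's \<Rightarrow> real) \<Rightarrow> bool" where
  "generalized_curvature V B \<longleftrightarrow>
     (\<forall>i j k. loc_integrable V (\<lambda>z. B z i j k)) \<and>
     (\<forall>\<phi> i. C1c \<phi> \<longrightarrow>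
        0 = integral\<^sup>L V (\<lambda>z. (\<Sum>j\<in>UNIV. (snd z) $ i $ j * Dx \<phi> j z)
               + (\<Sum>j\<in>UNIV. \<Sum>k\<in>UNIV. B z i j k * DP \<phi> j k z)
               + (\<Sum>j\<in>UNIV. B z j i j) * \<phi> z))"

text \<open>A^k_ij = P_lj B_ikl - P_lj P_iq dQ_kl/dx_q.\<close>
definition second_fundamental_form ::
  "(real^'s \<Rightarrow> real^'s^'s) \<Rightarrow> ((real^'s) \<times> (real^'s^'s) \<Rightarrow> 's \<Rightarrow> 's \<Rightarrow> 's \<Rightarrow> real) \<Rightarrow>
   (real^'s) \<times> (real^'s^'s) \<Rightarrow> 's \<Rightarrow> 's \<Rightarrow> 's \<Rightarrow> real" where
  "second_fundamental_form Q B z k i j =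
     (\<Sum>l\<in>UNIV. (snd z) $ l $ j * B z i k l)
     - (\<Sum>l\<in>UNIV. \<Sum>q\<in>UNIV. (snd z) $ l $ j * (snd z) $ i $ q * dQ Q q (fst z) k l)"

definition null_second_fundamental_form ::
  "(real^'s \<Rightarrow> real^'s^'s) \<Rightarrow> ((real^'s) \<times> (real^'s^'s)) measure \<Rightarrow> bool" where
  "null_second_fundamental_form Q V \<longleftrightarrow>
     (\<exists>B. generalized_curvature V B \<and>
          (AE z in V. \<forall>k i j. second_fundamental_form Q B z k i j = 0))"

section \<open>Weak mean curvature\<close>

definition weak_mean_curvature ::
  "((real^'s) \<times> (real^'s^'s)) measure \<Rightarrow> ((real^'s) \<times> (real^'s^'s) \<Rightarrow> real^'s) \<Rightarrow> bool" where
  "weak_mean_curvature V H \<longleftrightarrow> loc_integrable V H \<and>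
     (\<forall>X::real^'s \<Rightarrow> real^'s. C1c X \<longrightarrow>
        integral\<^sup>L V (\<lambda>z. divP (snd z) X (fst z)) = - integral\<^sup>L V (\<lambda>z. H z \<bullet> X (fst z)))"

text \<open>(H^N)_i = (H^{R^S})_i - P_jk dQ_ij/dx_k.\<close>
definition relative_mean_curvature ::
  "(real^'s \<Rightarrow> real^'s^'s) \<Rightarrow> ((real^'s) \<times> (real^'s^'s) \<Rightarrow> real^'s) \<Rightarrow> (real^'s) \<times> (real^'s^'s) \<Rightarrow> real^'s" where
  "relative_mean_curvature Q H z =
     (\<chi> i. H z $ i - (\<Sum>j\<in>UNIV. \<Sum>k\<in>UNIV. (snd z) $ j $ k * dQ Q k (fst z) i j))"

definition null_relative_mean_curvature ::
  "(real^'s \<Rightarrow> real^'s^'s) \<Rightarrow> ((real^'s) \<times> (real^'s^'s)) measure \<Rightarrow> bool" where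
  "null_relative_mean_curvature Q V \<longleftrightarrow>
     (\<exists>H. weak_mean_curvature V H \<and> (AE z in V. relative_mean_curvature Q H z = 0))"

end

theory Submission
  imports Defs
begin

text \<open>
  Proof idea. Let V be a non-zero m-varifold on N with generalized curvature B and null
  generalized second fundamental form. Write h(z)_i = sum_j sum_k B_jik P_kj. We show:
  (1) for every varifold on a compact set with generalized curvature B, the vector field h
      is a weak mean curvature in R^S. This follows from the defining identity of B applied
      to test functions g(x) chi(P) p(P), where chi is a smooth cutoff that equals 1 on the
      (bounded) set of orthogonal projections, and p runs through 1, P_pi, P_pi - P_ip and
      the entries of P^2 - P; a suitable linear combination of the resulting identities is
      exactly the first variation formula with mean curvature h.
  (2) Taking the trace A^i_jj of the second fundamental form and using P^2 = P shows
      h_i = sum_jk P_jk dQ_ij/dx_k, i.e. the mean curvature of V relative to Nbar vanishes.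
  Hence V has null weak mean curvature relative to Nbar, contradicting the hypothesis.
\<close>

subsection \<open>A smooth cutoff function\<close>

text \<open>The C^1 ramp t \<mapsto> max(0,t)^2, the building block of the cutoff.\<close>
definition ramp :: "real \<Rightarrow> real" where "ramp t = (max 0 t)^2"

lemma ramp_deriv: "(ramp has_real_derivative (2 * max 0 t)) (at t)"
proof (cases "t = 0")
  case True
  have "((\<lambda>y. (ramp y - ramp 0) / (y - 0)) \<longlongrightarrow> 0) (at 0)"
  proof (rule tendsto_0_le[where f="\<lambda>y. y" and K=1])
    show "((\<lambda>y. y) \<longlongrightarrow> (0::real)) (at 0)" by (simp add: tendsto_ident_at)
    show "\<forall>\<^sub>F x in at 0. norm ((ramp x - ramp 0) / (x - 0)) \<le> norm x * 1"
      by (auto simp: ramp_def power2_eq_square abs_mult max_def)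
  qed
  then show ?thesis using True by (simp add: has_field_derivative_iff)
next
  case False
  show ?thesis
  proof (cases "t > 0")
    case True
    have "((\<lambda>y. y^2) has_real_derivative (2 * max 0 t)) (at t)"
      using True by (auto intro!: derivative_eq_intros)
    then show ?thesis
      by (rule has_field_derivative_transform_within_open[where S="{0<..}"])
        (use True in \<open>auto simp: ramp_def\<close>)
  next
    case False
    with \<open>t \<noteq> 0\<close> have "t < 0" by simp
    have "((\<lambda>y. 0) has_real_derivative (2 * max 0 t)) (at t)" using \<open>t < 0\<close> by simp
    then show ?thesis
      by (rule has_field_derivative_transform_within_open[where S="{..<0}"])
        (use \<open>t < 0\<close> in \<open>auto simp: ramp_def\<close>)
  qed
qed

lemma ramp_reflected_deriv: "((\<lambda>t. ramp (1 - t)) has_real_derivative -(2 * max 0 (1 - s))) (at s)"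
proof -
  have "((\<lambda>t. 1 - t) has_real_derivative -1) (at s)"
    by (auto intro!: derivative_eq_intros)
  from DERIV_chain2[OF ramp_deriv[of "1 - s"] this] show ?thesis by simp
qed

lemma ramp_zero: "t \<le> 0 \<Longrightarrow> ramp t = 0"
  by (simp add: ramp_def)

text \<open>The denominator of the smooth step never vanishes.\<close>
lemma ramp_sum_pos: "ramp s + ramp (1 - s) > 0"
proof (cases "s > 0")
  case True
  then have "ramp s > 0" by (simp add: ramp_def)
  then show ?thesis by (simp add: add_pos_nonneg ramp_def)
next
  case False
  then have "ramp (1 - s) > 0" by (simp add: ramp_def)
  then show ?thesis by (simp add: add_nonneg_pos ramp_def)
qed

text \<open>A C^1 step function: 0 on (-\<infinity>,0], 1 on [1,\<infinity>), with explicit derivative.\<close>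
definition step :: "real \<Rightarrow> real" where "step s = ramp s / (ramp s + ramp (1 - s))"

definition step' :: "real \<Rightarrow> real" where
  "step' s = ((2 * max 0 s) * (ramp s + ramp (1 - s)) - ramp s * (2 * max 0 s - 2 * max 0 (1 - s)))
             / (ramp s + ramp (1 - s))^2"

lemma step_deriv: "(step has_real_derivative step' s) (at s)"
  unfolding step_def step'_def using ramp_sum_pos[of s]
  by (auto intro!: derivative_eq_intros ramp_deriv ramp_reflected_deriv simp: power2_eq_square)

lemma ramp_continuous: "continuous_on UNIV ramp"
  unfolding ramp_def by (intro continuous_intros)

lemma step'_continuous: "continuous_on UNIV step'"
  unfolding step'_def using ramp_sum_pos
  by (intro continuous_intros continuous_on_compose2[OF ramp_continuous]) (auto, metis less_irrefl)

lemma step_zero: "s \<le> 0 \<Longrightarrow> step s = 0"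
  by (simp add: step_def ramp_zero)

lemma step_one: "s \<ge> 1 \<Longrightarrow> step s = 1"
  using ramp_sum_pos[of s] by (simp add: step_def ramp_zero)

lemma step'_zero: "s \<ge> 1 \<Longrightarrow> step' s = 0"
  by (simp add: step'_def ramp_zero max_def)

text \<open>The cutoff on an inner product space: 1 where |P|^2 \<le> c - 1, 0 where |P|^2 \<ge> c.\<close>
definition cutoff :: "real \<Rightarrow> 'a::real_inner \<Rightarrow> real" where "cutoff c P = step (c - P \<bullet> P)"

definition cutoff' :: "real \<Rightarrow> 'a::real_inner \<Rightarrow> 'a \<Rightarrow> real" where
  "cutoff' c P v = step' (c - P \<bullet> P) * (- (2 * (P \<bullet> v)))"

lemma cutoff_deriv: "(cutoff c has_derivative cutoff' c P) (at P)"
proof -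
  have "((\<lambda>P. c - P \<bullet> P) has_derivative (\<lambda>v. - (2 * (P \<bullet> v)))) (at P)"
    by (auto intro!: derivative_eq_intros simp: inner_commute)
  from has_derivative_compose[OF this step_deriv[unfolded has_field_derivative_def]]
  show ?thesis unfolding cutoff_def cutoff'_def by (simp add: o_def mult.commute)
qed

lemma cutoff_one: "P \<bullet> P \<le> c - 1 \<Longrightarrow> cutoff c P = 1"
  by (simp add: cutoff_def step_one)

lemma cutoff'_zero: "P \<bullet> P \<le> c - 1 \<Longrightarrow> cutoff' c P v = 0"
  by (simp add: cutoff'_def step'_zero)

lemma cutoff_support: "cutoff c P \<noteq> 0 \<Longrightarrow> norm P \<le> sqrt c"
proof -
  assume "cutoff c P \<noteq> 0"
  then have "P \<bullet> P \<le> c" using step_zero[of "c - P \<bullet> P"] unfolding cutoff_def by linarith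
  then show ?thesis by (simp add: norm_eq_sqrt_inner)
qed

subsection \<open>C^1 functions with an explicit derivative\<close>

text \<open>f is differentiable everywhere with derivative f', and every directional derivative
  x \<mapsto> f' x v is continuous; this is the form in which test functions are built.\<close>
definition C1_deriv :: "('a::real_normed_vector \<Rightarrow> 'b::real_normed_vector) \<Rightarrow> ('a \<Rightarrow> 'a \<Rightarrow> 'b) \<Rightarrow> bool" where
  "C1_deriv f f' \<longleftrightarrow> (\<forall>x. (f has_derivative f' x) (at x)) \<and> (\<forall>v. continuous_on UNIV (\<lambda>x. f' x v))"

lemma C1_deriv_continuous: "C1_deriv f f' \<Longrightarrow> continuous_on UNIV f"
  unfolding C1_deriv_def by (meson continuous_at_imp_continuous_on has_derivative_continuous)

lemma C1_deriv_continuous_deriv: "C1_deriv f f' \<Longrightarrow> continuous_on UNIV (\<lambda>x. f' x v)"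
  unfolding C1_deriv_def by blast

lemma C1_deriv_zero_direction: "C1_deriv f f' \<Longrightarrow> f' x 0 = 0"
  unfolding C1_deriv_def by (meson has_derivative_bounded_linear bounded_linear.linear linear_0)

lemma C1_deriv_frechet: "C1_deriv f f' \<Longrightarrow> frechet_derivative f (at x) = f' x"
  unfolding C1_deriv_def by (metis frechet_derivative_at)

text \<open>A C^1 function with compact support is a test function in the sense of C1c; the
  componentwise continuity of f' gives continuity of the derivative in operator norm.\<close>
lemma C1_deriv_imp_C1c:
  fixes f :: "'a::euclidean_space \<Rightarrow> 'b::euclidean_space"
  assumes "C1_deriv f f'" and "compact (closure {x. f x \<noteq> 0})"
  shows "C1c f"
proof -
  have lin: "bounded_linear (f' x)" for x
    using assms(1) has_derivative_bounded_linear unfolding C1_deriv_def by blast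
  have "(f has_derivative blinfun_apply (Blinfun (f' x))) (at x)" for x
    using assms(1) lin by (simp add: C1_deriv_def bounded_linear_Blinfun_apply)
  moreover have "continuous_on UNIV (\<lambda>x. Blinfun (f' x))"
    by (rule continuous_on_blinfun_componentwise)
      (use assms(1) lin in \<open>simp add: C1_deriv_def bounded_linear_Blinfun_apply\<close>)
  ultimately show ?thesis
    using assms(2) unfolding C1c_def by (intro conjI exI[of _ "\<lambda>x. Blinfun (f' x)"]) auto
qed

lemma C1_deriv_linear: "bounded_linear f \<Longrightarrow> C1_deriv f (\<lambda>x. f)"
  by (simp add: C1_deriv_def bounded_linear.has_derivative[OF _ has_derivative_ident])

lemma C1_deriv_const: "C1_deriv (\<lambda>x. k) (\<lambda>x v. 0)"
  by (simp add: C1_deriv_def)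

lemma C1_deriv_mult:
  fixes f g :: "'a::real_normed_vector \<Rightarrow> real"
  assumes f: "C1_deriv f f'" and g: "C1_deriv g g'"
  shows "C1_deriv (\<lambda>x. f x * g x) (\<lambda>x v. f' x v * g x + f x * g' x v)"
  unfolding C1_deriv_def
proof (intro conjI allI)
  fix x
  have "(f has_derivative f' x) (at x)" "(g has_derivative g' x) (at x)"
    using f g unfolding C1_deriv_def by auto
  from has_derivative_mult[OF this]
  show "((\<lambda>x. f x * g x) has_derivative (\<lambda>v. f' x v * g x + f x * g' x v)) (at x)"
    by (rule has_derivative_eq_rhs) (simp add: fun_eq_iff algebra_simps)
next
  fix v
  show "continuous_on UNIV (\<lambda>x. f' x v * g x + f x * g' x v)"
    using f g by (intro continuous_intros C1_deriv_continuous C1_deriv_continuous_deriv)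
qed

lemma C1_deriv_fst:
  fixes f :: "'a::real_normed_vector \<Rightarrow> 'c::real_normed_vector"
  assumes "C1_deriv f f'"
  shows "C1_deriv (\<lambda>z::'a::real_normed_vector \<times> 'b::real_normed_vector. f (fst z)) (\<lambda>z v. f' (fst z) (fst v))"
  unfolding C1_deriv_def
proof (intro conjI allI)
  fix z :: "'a \<times> 'b"
  have "(f has_derivative f' (fst z)) (at (fst z))"
    using assms unfolding C1_deriv_def by blast
  from has_derivative_compose[OF has_derivative_fst[OF has_derivative_ident] this]
  show "((\<lambda>z. f (fst z)) has_derivative (\<lambda>v. f' (fst z) (fst v))) (at z)"
    by simp
next
  fix v :: "'a \<times> 'b"
  show "continuous_on UNIV (\<lambda>z::'a \<times> 'b. f' (fst z) (fst v))"
    by (rule continuous_on_compose2[OF C1_deriv_continuous_deriv[OF assms]]) (auto intro: continuous_intros)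
qed

lemma C1_deriv_snd:
  fixes f :: "'b::real_normed_vector \<Rightarrow> 'c::real_normed_vector"
  assumes "C1_deriv f f'"
  shows "C1_deriv (\<lambda>z::'a::real_normed_vector \<times> 'b::real_normed_vector. f (snd z)) (\<lambda>z v. f' (snd z) (snd v))"
  unfolding C1_deriv_def
proof (intro conjI allI)
  fix z :: "'a \<times> 'b"
  have "(f has_derivative f' (snd z)) (at (snd z))"
    using assms unfolding C1_deriv_def by blast
  from has_derivative_compose[OF has_derivative_snd[OF has_derivative_ident] this]
  show "((\<lambda>z. f (snd z)) has_derivative (\<lambda>v. f' (snd z) (snd v))) (at z)"
    by simp
next
  fix v :: "'a \<times> 'b"
  show "continuous_on UNIV (\<lambda>z::'a \<times> 'b. f' (snd z) (snd v))"
    by (rule continuous_on_compose2[OF C1_deriv_continuous_deriv[OF assms]]) (auto intro: continuous_intros)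
qed

lemma C1_deriv_cutoff: "C1_deriv (cutoff c) (cutoff' c)"
  unfolding C1_deriv_def
proof (intro conjI allI)
  show "(cutoff c has_derivative cutoff' c P) (at P)" for P by (rule cutoff_deriv)
  show "continuous_on UNIV (\<lambda>P. cutoff' c P v)" for v
    unfolding cutoff'_def by (intro continuous_intros continuous_on_compose2[OF step'_continuous]) auto
qed

text \<open>The test functions used for the generalized curvature: g(x) \<chi>(P) p(P), where the
  cutoff \<chi> makes the support compact in the P-variable.\<close>
definition test_function ::
  "real \<Rightarrow> ('a \<Rightarrow> real) \<Rightarrow> ('b::real_inner \<Rightarrow> real) \<Rightarrow> 'a \<times> 'b \<Rightarrow> real" where
  "test_function c g p z = g (fst z) * cutoff c (snd z) * p (snd z)"

lemma test_function_C1_deriv: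
  assumes "C1_deriv g g'" and "C1_deriv p p'"
  shows "C1_deriv (test_function c g p)
    (\<lambda>z v. (g' (fst z) (fst v) * cutoff c (snd z) + g (fst z) * cutoff' c (snd z) (snd v)) * p (snd z)
           + g (fst z) * cutoff c (snd z) * p' (snd z) (snd v))"
  unfolding test_function_def
  by (intro C1_deriv_mult C1_deriv_fst C1_deriv_snd C1_deriv_cutoff assms)

lemma test_function_C1c:
  fixes g :: "'a::euclidean_space \<Rightarrow> real" and p :: "'b::euclidean_space \<Rightarrow> real"
  assumes "C1_deriv g g'" and "C1_deriv p p'" and "compact (closure {x. g x \<noteq> 0})"
  shows "C1c (test_function c g p)"
proof (rule C1_deriv_imp_C1c[OF test_function_C1_deriv[OF assms(1,2)]])
  have support: "{z. test_function c g p z \<noteq> 0} \<subseteq> closure {x. g x \<noteq> 0} \<times> cball 0 (sqrt c)"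
  proof
    fix z assume "z \<in> {z. test_function c g p z \<noteq> 0}"
    then have "g (fst z) \<noteq> 0" and "cutoff c (snd z) \<noteq> 0"
      by (auto simp: test_function_def)
    then have "fst z \<in> closure {x. g x \<noteq> 0}" and "snd z \<in> cball 0 (sqrt c)"
      using closure_subset[of "{x. g x \<noteq> 0}"] cutoff_support[of c "snd z"] by auto
    then show "z \<in> closure {x. g x \<noteq> 0} \<times> cball 0 (sqrt c)"
      by (simp add: mem_Times_iff)
  qed
  have "bounded (closure {x. g x \<noteq> 0} \<times> cball (0::'b) (sqrt c))"
    using assms(3) by (intro compact_imp_bounded compact_Times compact_cball)
  then have "bounded {z. test_function c g p z \<noteq> 0}"
    by (rule bounded_subset[OF _ support])
  then show "compact (closure {z. test_function c g p z \<noteq> 0})"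
    by (simp only: compact_closure)
qed

subsection \<open>Entries of matrices\<close>

lemma bounded_linear_entry: "bounded_linear (\<lambda>P::real^'s^'s. P $ a $ b)"
  using bounded_linear_compose[OF bounded_linear_vec_nth[of b] bounded_linear_vec_nth[of a]] by simp

lemma C1_deriv_entry: "C1_deriv (\<lambda>P::real^'s^'s. P $ a $ b) (\<lambda>P v. v $ a $ b)"
  by (rule C1_deriv_linear[OF bounded_linear_entry])

lemma C1_deriv_antisym_entry:
  "C1_deriv (\<lambda>P::real^'s^'s. P $ a $ b - P $ b $ a) (\<lambda>P v. v $ a $ b - v $ b $ a)"
  by (intro C1_deriv_linear bounded_linear_sub bounded_linear_entry)

text \<open>The (a,b) entry of the idempotence defect P^2 - P, and its derivative.\<close>
lemma C1_deriv_idempotence_defect: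
  "C1_deriv (\<lambda>P::real^'s^'s. (P ** P) $ a $ b - P $ a $ b)
            (\<lambda>P v. (v ** P) $ a $ b + (P ** v) $ a $ b - v $ a $ b)"
  unfolding C1_deriv_def
proof (intro conjI allI)
  fix P :: "real^'s^'s"
  have entry: "((\<lambda>P::real^'s^'s. P $ a $ b) has_derivative (\<lambda>v. v $ a $ b)) (at P)" for a b
    by (rule bounded_linear.has_derivative[OF bounded_linear_entry has_derivative_ident])
  have "((\<lambda>P::real^'s^'s. (\<Sum>k\<in>UNIV. P $ a $ k * P $ k $ b) - P $ a $ b) has_derivative
     (\<lambda>v. (\<Sum>k\<in>UNIV. P $ a $ k * v $ k $ b + v $ a $ k * P $ k $ b) - v $ a $ b)) (at P)"
    by (intro has_derivative_diff has_derivative_sum has_derivative_mult entry)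
  then show "((\<lambda>P::real^'s^'s. (P ** P) $ a $ b - P $ a $ b) has_derivative
     (\<lambda>v. (v ** P) $ a $ b + (P ** v) $ a $ b - v $ a $ b)) (at P)"
    by (simp add: matrix_matrix_mult_def sum.distrib algebra_simps)
next
  fix v :: "real^'s^'s"
  show "continuous_on UNIV (\<lambda>P. (v ** P) $ a $ b + (P ** v) $ a $ b - v $ a $ b)"
    unfolding matrix_matrix_mult_def by (simp add: continuous_intros)
qed

text \<open>Matrix units E_jk = e_j e_k^T: extracting coefficients and multiplying.\<close>
lemma matrix_unit_entry: "axis j (axis k (1::real)) $ a $ b = (if j = a \<and> k = b then 1 else 0)"
  by (auto simp: axis_def)

lemma sum_matrix_unit_entry:
  "(\<Sum>j\<in>UNIV. \<Sum>k\<in>UNIV. f j k * axis j (axis k (1::real)) $ a $ b) = f a b"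
proof -
  have "f j k * axis j (axis k (1::real)) $ a $ b = (if k = b then (if j = a then f j k else 0) else 0)"
    for j k by (auto simp: matrix_unit_entry)
  then show ?thesis by (simp add: sum.delta)
qed

lemma matrix_unit_mult_left: "(axis p (axis k (1::real)) ** P) $ a $ b = (if p = a then P $ k $ b else 0)"
proof -
  have "axis p (axis k (1::real)) $ a $ r * P $ r $ b = (if r = k then (if p = a then P $ k $ b else 0) else 0)"
    for r by (auto simp: matrix_unit_entry)
  then show ?thesis unfolding matrix_matrix_mult_def by simp
qed

lemma matrix_unit_mult_right: "(P ** axis p (axis k (1::real))) $ a $ b = (if k = b then P $ a $ p else 0)"
proof -
  have "P $ a $ r * axis p (axis k (1::real)) $ r $ b = (if r = p then (if k = b then P $ a $ p else 0) else 0)"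
    for r by (auto simp: matrix_unit_entry)
  then show ?thesis unfolding matrix_matrix_mult_def by simp
qed

subsection \<open>Orthogonal projections\<close>

lemma symmetric_entry: "transpose P = P \<Longrightarrow> P $ a $ b = P $ b $ a"
proof -
  assume "transpose P = P"
  moreover have "transpose P $ a $ b = P $ b $ a" by (simp add: transpose_def)
  ultimately show ?thesis by simp
qed

lemma idempotent_entry: "P ** P = P \<Longrightarrow> (\<Sum>k\<in>UNIV. P $ a $ k * P $ k $ b) = (P $ a $ b :: real)"
proof -
  assume "P ** P = P"
  moreover have "(P ** P) $ a $ b = (\<Sum>k\<in>UNIV. P $ a $ k * P $ k $ b)" by (simp add: matrix_matrix_mult_def)
  ultimately show ?thesis by simp
qed

text \<open>An orthogonal projection has squared Frobenius norm trace P \<le> S, so the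
  Grassmannian lies in a fixed ball; this is where the cutoff equals 1.\<close>
lemma projection_norm_bound:
  fixes P :: "real^'s^'s"
  assumes sym: "transpose P = P" and idem: "P ** P = P"
  shows "P \<bullet> P \<le> real CARD('s)"
proof -
  have row: "(\<Sum>j\<in>UNIV. (P $ a $ j)^2) = P $ a $ a" for a
    using idempotent_entry[OF idem, of a a] symmetric_entry[OF sym]
    by (simp add: power2_eq_square)
  have diag: "P $ a $ a \<le> 1" for a
  proof -
    have "(P $ a $ a)^2 \<le> (\<Sum>j\<in>UNIV. (P $ a $ j)^2)"
      by (rule member_le_sum) auto
    then have "(P $ a $ a)^2 \<le> P $ a $ a" using row by simp
    then have "P $ a $ a * P $ a $ a \<le> P $ a $ a * 1" by (simp add: power2_eq_square)
    then show ?thesis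
      by (cases "P $ a $ a \<le> 1") (auto dest: mult_strict_left_mono[of 1 "P $ a $ a" "P $ a $ a"])
  qed
  have "P \<bullet> P = (\<Sum>a\<in>UNIV. \<Sum>j\<in>UNIV. (P $ a $ j)^2)"
    by (simp add: inner_vec_def power2_eq_square)
  also have "\<dots> = (\<Sum>a\<in>UNIV. P $ a $ a)" by (simp add: row)
  also have "\<dots> \<le> (\<Sum>a\<in>(UNIV::'s set). 1)" by (rule sum_mono) (rule diag)
  finally show ?thesis by simp
qed

subsection \<open>Varifolds on a compact set with a generalized curvature\<close>

text \<open>Locally integrable functions on R^k are Borel measurable: they are pointwise limits
  of their (integrable, hence measurable) restrictions to the balls cball 0 n.\<close>
lemma loc_integrable_measurable:
  fixes V :: "'a::euclidean_space measure" and f :: "'a \<Rightarrow> real"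
  assumes sets: "sets V = sets borel" and f: "loc_integrable V f"
  shows "f \<in> borel_measurable borel"
proof (rule borel_measurable_LIMSEQ_real[where u="\<lambda>n z. indicator (cball 0 (real n)) z * f z"])
  fix z :: 'a
  obtain n0 :: nat where "norm z \<le> real n0" using real_arch_simple by blast
  then have "\<forall>n\<ge>n0. indicator (cball 0 (real n)) z * f z = f z"
    by (auto simp: indicator_def)
  then show "(\<lambda>n. indicator (cball 0 (real n)) z * f z) \<longlonglongrightarrow> f z"
    by (intro tendsto_eventually) (auto simp: eventually_sequentially)
next
  fix n :: nat
  have "set_integrable V (cball 0 (real n)) f" using f unfolding loc_integrable_def by auto
  then have "(\<lambda>z. indicator (cball 0 (real n)) z *\<^sub>R f z) \<in> borel_measurable V"
    unfolding set_integrable_def by (rule borel_measurable_integrable)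
  moreover have "borel_measurable V = (borel_measurable borel :: ('a \<Rightarrow> real) set)"
    by (rule measurable_cong_sets[OF sets refl])
  ultimately show "(\<lambda>z. indicator (cball 0 (real n)) z * f z) \<in> borel_measurable borel"
    by simp
qed

text \<open>The setting of the first step of the proof: an m-varifold V on a compact set N
  with generalized curvature B. Such a V is a finite measure concentrated on a compact set,
  and almost every P is an orthogonal projection.\<close>
locale curved_varifold =
  fixes m :: nat and N :: "(real^'s::finite) set" and Q :: "real^'s \<Rightarrow> real^'s^'s"
    and V :: "((real^'s) \<times> (real^'s^'s)) measure"
    and B :: "(real^'s) \<times> (real^'s^'s) \<Rightarrow> 's \<Rightarrow> 's \<Rightarrow> 's \<Rightarrow> real"
  assumes varifold: "varifold m N Q V"
    and compact_N: "compact N"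
    and curvature: "generalized_curvature V B"
begin

lemma sets_V: "sets V = sets borel"
  using varifold unfolding varifold_def by blast

lemma space_V: "space V = UNIV"
  using sets_eq_imp_space_eq[OF sets_V] by simp

lemma measurable_V: "f \<in> borel_measurable borel \<Longrightarrow> f \<in> borel_measurable V"
  using measurable_cong_sets[OF sets_V refl] by blast

lemma continuous_measurable_V: "continuous_on UNIV f \<Longrightarrow> f \<in> borel_measurable V"
  by (intro measurable_V borel_measurable_continuous_onI)

lemma ae_projection: "AE z in V. fst z \<in> N \<and> transpose (snd z) = snd z \<and> snd z ** snd z = snd z"
  using varifold unfolding varifold_def by (auto elim!: eventually_mono simp: Gm_def grassmannian_def)

lemma concentrated_on_compact:
  obtains K where "compact K" and "AE z in V. z \<in> K"
proof
  show "compact (N \<times> cball (0::real^'s^'s) (sqrt (real CARD('s))))"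
    by (intro compact_Times compact_N compact_cball)
  show "AE z in V. z \<in> N \<times> cball 0 (sqrt (real CARD('s)))"
    using ae_projection
  proof (rule eventually_mono)
    fix z :: "(real^'s) \<times> (real^'s^'s)"
    assume "fst z \<in> N \<and> transpose (snd z) = snd z \<and> snd z ** snd z = snd z"
    then show "z \<in> N \<times> cball 0 (sqrt (real CARD('s)))"
      using projection_norm_bound[of "snd z"] by (auto simp: mem_Times_iff norm_eq_sqrt_inner)
  qed
qed

lemma finite_total_measure: "emeasure V (space V) \<noteq> \<infinity>"
proof -
  obtain K where K: "compact K" "AE z in V. z \<in> K" by (rule concentrated_on_compact)
  have K_sets: "K \<in> sets V" and co_K_sets: "UNIV - K \<in> sets V"
    using K(1) unfolding sets_V by (auto intro: borel_closed borel_open compact_imp_closed)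
  have "emeasure V (UNIV - K) = 0"
    using AE_iff_measurable[OF co_K_sets, of "\<lambda>z. z \<in> K"] K(2) space_V by auto
  then have "emeasure V UNIV \<le> emeasure V K"
    using emeasure_subadditive[OF K_sets co_K_sets] by simp
  moreover have "emeasure V K < \<infinity>"
    using varifold K(1) unfolding varifold_def by blast
  ultimately show ?thesis using space_V by (auto simp: top_unique)
qed

sublocale finite_measure V
  by (rule finite_measureI) (rule finite_total_measure)

text \<open>Continuous functions are bounded on the compact set carrying V, hence integrable.\<close>
lemma continuous_bounded_ae:
  fixes f :: "_ \<Rightarrow> 'b::real_normed_vector"
  assumes "continuous_on UNIV f"
  shows "\<exists>M. AE z in V. norm (f z) \<le> M"
proof -
  obtain K where K: "compact K" "AE z in V. z \<in> K" by (rule concentrated_on_compact)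
  have "compact (f ` K)"
    by (rule compact_continuous_image[OF continuous_on_subset[OF assms] K(1)]) simp
  then obtain M where "\<forall>y\<in>f ` K. norm y \<le> M"
    using compact_imp_bounded bounded_iff by metis
  then show ?thesis using K(2) by (auto elim!: eventually_mono)
qed

lemma continuous_integrable:
  fixes f :: "_ \<Rightarrow> 'b::{banach,second_countable_topology}"
  assumes "continuous_on UNIV f"
  shows "integrable V f"
proof -
  obtain M where "AE z in V. norm (f z) \<le> M" using continuous_bounded_ae[OF assms] by blast
  then show ?thesis by (intro integrable_const_bound[where B=M] continuous_measurable_V assms)
qed

lemma curvature_measurable: "(\<lambda>z. B z i j k) \<in> borel_measurable V"
  using curvature unfolding generalized_curvature_def
  by (blast intro: measurable_V loc_integrable_measurable[OF sets_V])

text \<open>B is integrable, not only locally: V lives on a compact set.\<close>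
lemma curvature_integrable: "integrable V (\<lambda>z. B z i j k)"
proof -
  obtain K where K: "compact K" "AE z in V. z \<in> K" by (rule concentrated_on_compact)
  have "set_integrable V K (\<lambda>z. B z i j k)"
    using curvature K(1) unfolding generalized_curvature_def loc_integrable_def by blast
  then have "integrable V (\<lambda>z. indicator K z *\<^sub>R B z i j k)" by (simp add: set_integrable_def)
  then show ?thesis
    by (rule integrable_cong_AE_imp) (use K(2) curvature_measurable in \<open>auto elim!: eventually_mono\<close>)
qed

lemma curvature_times_continuous_integrable:
  assumes "continuous_on UNIV f"
  shows "integrable V (\<lambda>z. B z i j k * f z)"
proof -
  obtain M where M: "AE z in V. norm (f z) \<le> M" using continuous_bounded_ae[OF assms] by blast
  have bound: "AE z in V. norm (B z i j k * f z) \<le> norm (M * B z i j k)"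
    using M by (auto elim!: eventually_mono simp: abs_mult mult.commute[of "\<bar>B _ _ _ _\<bar>"]
        intro!: mult_right_mono)
  have meas: "(\<lambda>z. B z i j k * f z) \<in> borel_measurable V"
    by (intro borel_measurable_times curvature_measurable continuous_measurable_V assms)
  have "integrable V (\<lambda>z. M * B z i j k)"
    using curvature_integrable by simp
  from Bochner_Integration.integrable_bound[OF this meas bound] show ?thesis .
qed

text \<open>Almost every P lies where the cutoff with level S + 1 is identically 1.\<close>
lemma ae_inside_cutoff: "AE z in V. snd z \<bullet> snd z \<le> (real CARD('s) + 1) - 1"
  using ae_projection by (rule eventually_mono) (simp add: projection_norm_bound)

end

subsection \<open>The first variation identity for product test functions\<close>

context curved_varifold
begin

text \<open>The integrand of the defining identity of B for the test function g(x) p(P). The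
  cutoff in the P-variable is omitted: it is identically 1 near almost every P.\<close>
definition first_variation ::
  "(real^'s \<Rightarrow> real) \<Rightarrow> (real^'s \<Rightarrow> real^'s \<Rightarrow> real) \<Rightarrow> (real^'s^'s \<Rightarrow> real) \<Rightarrow>
   (real^'s^'s \<Rightarrow> real^'s^'s \<Rightarrow> real) \<Rightarrow> 's \<Rightarrow> (real^'s) \<times> (real^'s^'s) \<Rightarrow> real" where
  "first_variation g g' p p' i z =
     (\<Sum>j\<in>UNIV. snd z $ i $ j * g' (fst z) (axis j 1)) * p (snd z)
     + g (fst z) * (\<Sum>j\<in>UNIV. \<Sum>k\<in>UNIV. B z i j k * p' (snd z) (axis j (axis k 1)))
     + (\<Sum>j\<in>UNIV. B z j i j) * g (fst z) * p (snd z)"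

lemma first_variation_integrable:
  assumes g: "C1_deriv g g'" and p: "C1_deriv p p'"
  shows "integrable V (first_variation g g' p p' i)"
proof -
  have g_cont: "continuous_on UNIV (\<lambda>z::(real^'s) \<times> (real^'s^'s). g (fst z))"
    using C1_deriv_continuous[OF C1_deriv_fst[OF g]] .
  have g'_cont: "continuous_on UNIV (\<lambda>z::(real^'s) \<times> (real^'s^'s). g' (fst z) w)" for w
    using C1_deriv_continuous_deriv[OF C1_deriv_fst[OF g], of "(w, 0)"] by simp
  have p_cont: "continuous_on UNIV (\<lambda>z::(real^'s) \<times> (real^'s^'s). p (snd z))"
    using C1_deriv_continuous[OF C1_deriv_snd[OF p]] .
  have p'_cont: "continuous_on UNIV (\<lambda>z::(real^'s) \<times> (real^'s^'s). p' (snd z) W)" for W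
    using C1_deriv_continuous_deriv[OF C1_deriv_snd[OF p], of "(0, W)"] by simp
  have entry_cont: "continuous_on UNIV (\<lambda>z::(real^'s) \<times> (real^'s^'s). snd z $ i $ j)" for i j
    by (intro continuous_intros)
  have "integrable V (\<lambda>z. (\<Sum>j\<in>UNIV. snd z $ i $ j * g' (fst z) (axis j 1) * p (snd z))
     + (\<Sum>j\<in>UNIV. \<Sum>k\<in>UNIV. B z i j k * (g (fst z) * p' (snd z) (axis j (axis k 1))))
     + (\<Sum>j\<in>UNIV. B z j i j * (g (fst z) * p (snd z))))"
    by (intro Bochner_Integration.integrable_add Bochner_Integration.integrable_sum
        curvature_times_continuous_integrable continuous_integrable continuous_intros
        g_cont g'_cont p_cont p'_cont entry_cont)
  moreover have "first_variation g g' p p' i = (\<lambda>z. (\<Sum>j\<in>UNIV. snd z $ i $ j * g' (fst z) (axis j 1) * p (snd z))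
     + (\<Sum>j\<in>UNIV. \<Sum>k\<in>UNIV. B z i j k * (g (fst z) * p' (snd z) (axis j (axis k 1))))
     + (\<Sum>j\<in>UNIV. B z j i j * (g (fst z) * p (snd z))))"
    by (simp add: fun_eq_iff first_variation_def sum_distrib_left sum_distrib_right mult_ac)
  ultimately show ?thesis by simp
qed

text \<open>The defining identity of B, applied to the test function g(x) \<chi>(P) p(P): since the
  cutoff \<chi> is 1 (with vanishing derivative) near almost every P, the first variation of
  g(x) p(P) integrates to zero.\<close>
lemma first_variation_has_integral_zero:
  assumes g: "C1_deriv g g'" and g_supp: "compact (closure {x. g x \<noteq> 0})"
    and p: "C1_deriv p p'"
  shows "has_bochner_integral V (first_variation g g' p p' i) 0"
proof -
  define c where "c = real CARD('s) + 1"
  define \<phi> where "\<phi> = test_function c g p"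
  define \<phi>' where "\<phi>' = (\<lambda>(z::(real^'s) \<times> (real^'s^'s)) v.
      (g' (fst z) (fst v) * cutoff c (snd z) + g (fst z) * cutoff' c (snd z) (snd v)) * p (snd z)
      + g (fst z) * cutoff c (snd z) * p' (snd z) (snd v))"
  have \<phi>_C1: "C1_deriv \<phi> \<phi>'"
    unfolding \<phi>_def \<phi>'_def by (rule test_function_C1_deriv[OF g p])
  have "C1c \<phi>" unfolding \<phi>_def by (rule test_function_C1c[OF g p g_supp])
  then have "0 = integral\<^sup>L V (\<lambda>z. (\<Sum>j\<in>UNIV. snd z $ i $ j * Dx \<phi> j z)
      + (\<Sum>j\<in>UNIV. \<Sum>k\<in>UNIV. B z i j k * DP \<phi> j k z) + (\<Sum>j\<in>UNIV. B z j i j) * \<phi> z)"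
    using curvature unfolding generalized_curvature_def by blast
  also have "\<dots> = integral\<^sup>L V (\<lambda>z. (\<Sum>j\<in>UNIV. snd z $ i $ j * \<phi>' z (axis j 1, 0))
      + (\<Sum>j\<in>UNIV. \<Sum>k\<in>UNIV. B z i j k * \<phi>' z (0, axis j (axis k 1))) + (\<Sum>j\<in>UNIV. B z j i j) * \<phi> z)"
    (is "_ = integral\<^sup>L V ?F")
    by (simp add: Dx_def DP_def C1_deriv_frechet[OF \<phi>_C1])
  also have "\<dots> = integral\<^sup>L V (first_variation g g' p p' i)"
  proof (rule integral_cong_AE)
    show "?F \<in> borel_measurable V"
      by (intro borel_measurable_add borel_measurable_sum borel_measurable_times curvature_measurable
          continuous_measurable_V continuous_intros C1_deriv_continuous[OF \<phi>_C1]
          C1_deriv_continuous_deriv[OF \<phi>_C1])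
    show "first_variation g g' p p' i \<in> borel_measurable V"
      by (rule borel_measurable_integrable[OF first_variation_integrable[OF g p]])
    show "AE z in V. ?F z = first_variation g g' p p' i z"
      using ae_inside_cutoff
    proof (rule eventually_mono)
      fix z :: "(real^'s) \<times> (real^'s^'s)"
      assume "snd z \<bullet> snd z \<le> (real CARD('s) + 1) - 1"
      then have "cutoff c (snd z) = 1" and "cutoff' c (snd z) W = 0" for W
        unfolding c_def by (auto intro: cutoff_one cutoff'_zero)
      moreover have "g' x 0 = 0" and "p' P 0 = 0" for x P
        using C1_deriv_zero_direction[OF g] C1_deriv_zero_direction[OF p] by auto
      ultimately show "?F z = first_variation g g' p p' i z"
        by (simp add: first_variation_def \<phi>_def \<phi>'_def test_function_def
            sum_distrib_right sum_distrib_left mult_ac)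
    qed
  qed
  finally show ?thesis
    using first_variation_integrable[OF g p] by (simp add: has_bochner_integral_iff)
qed

end

subsection \<open>Combining the identities: pointwise algebra\<close>

text \<open>The vector field which will turn out to be the weak mean curvature of V:
  h(z)_i = sum_j sum_k B_jik P_kj.\<close>
definition curvature_vector ::
  "((real^'s::finite) \<times> (real^'s^'s) \<Rightarrow> 's \<Rightarrow> 's \<Rightarrow> 's \<Rightarrow> real) \<Rightarrow> (real^'s) \<times> (real^'s^'s) \<Rightarrow> real^'s" where
  "curvature_vector B z = (\<chi> i. \<Sum>j\<in>UNIV. \<Sum>k\<in>UNIV. B z j i k * snd z $ k $ j)"

context curved_varifold
begin

text \<open>The contraction sum_j B_jaj, which appears in the zeroth order term of the identity.\<close>
definition curvature_trace :: "(real^'s) \<times> (real^'s^'s) \<Rightarrow> 's \<Rightarrow> real" where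
  "curvature_trace z a = (\<Sum>j\<in>UNIV. B z j a j)"

text \<open>The first variation for the four kinds of polynomial p(P) used below.\<close>
lemma first_variation_const:
  "first_variation g g' (\<lambda>P. 1) (\<lambda>P v. 0) i z =
     (\<Sum>j\<in>UNIV. snd z $ i $ j * g' (fst z) (axis j 1)) + curvature_trace z i * g (fst z)"
  by (simp add: first_variation_def curvature_trace_def)

lemma first_variation_entry:
  "first_variation g g' (\<lambda>P. P $ a $ b) (\<lambda>P v. v $ a $ b) a z =
     (\<Sum>j\<in>UNIV. snd z $ a $ j * g' (fst z) (axis j 1)) * snd z $ a $ b + g (fst z) * B z a a b
     + curvature_trace z a * g (fst z) * snd z $ a $ b"
  by (simp add: first_variation_def curvature_trace_def sum_matrix_unit_entry)

lemma first_variation_antisym_entry: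
  assumes "snd z $ a $ b = snd z $ b $ a"
  shows "first_variation g g' (\<lambda>P. P $ a $ b - P $ b $ a) (\<lambda>P v. v $ a $ b - v $ b $ a) a z =
     g (fst z) * (B z a a b - B z a b a)"
proof -
  have "(\<Sum>j\<in>UNIV. \<Sum>k\<in>UNIV. B z a j k * (axis j (axis k (1::real)) $ a $ b - axis j (axis k 1) $ b $ a))
     = (\<Sum>j\<in>UNIV. \<Sum>k\<in>UNIV. B z a j k * axis j (axis k (1::real)) $ a $ b)
       - (\<Sum>j\<in>UNIV. \<Sum>k\<in>UNIV. B z a j k * axis j (axis k (1::real)) $ b $ a)"
    by (simp add: right_diff_distrib sum_subtractf)
  then show ?thesis using assms by (simp add: first_variation_def sum_matrix_unit_entry)
qed

lemma first_variation_idempotence_defect: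
  assumes "(snd z ** snd z) $ a $ b = snd z $ a $ b"
  shows "first_variation g g' (\<lambda>P. (P ** P) $ a $ b - P $ a $ b)
      (\<lambda>P v. (v ** P) $ a $ b + (P ** v) $ a $ b - v $ a $ b) j z =
    g (fst z) * ((\<Sum>k\<in>UNIV. B z j a k * snd z $ k $ b) + (\<Sum>p\<in>UNIV. B z j p b * snd z $ a $ p) - B z j a b)"
proof -
  let ?E = "\<lambda>p k. axis p (axis k (1::real))"
  have left: "(\<Sum>p\<in>UNIV. \<Sum>k\<in>UNIV. B z j p k * (?E p k ** snd z) $ a $ b) = (\<Sum>k\<in>UNIV. B z j a k * snd z $ k $ b)"
  proof -
    have "(\<Sum>k\<in>UNIV. B z j p k * (?E p k ** snd z) $ a $ b)
        = (if p = a then (\<Sum>k\<in>UNIV. B z j a k * snd z $ k $ b) else 0)" for p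
      by (cases "p = a") (simp_all add: matrix_unit_mult_left)
    then show ?thesis by (simp add: sum.delta)
  qed
  have right: "(\<Sum>p\<in>UNIV. \<Sum>k\<in>UNIV. B z j p k * (snd z ** ?E p k) $ a $ b) = (\<Sum>p\<in>UNIV. B z j p b * snd z $ a $ p)"
    by (simp add: matrix_unit_mult_right if_distrib[of "\<lambda>x. _ * x"] sum.delta' cong: if_cong)
  have "(\<Sum>p\<in>UNIV. \<Sum>k\<in>UNIV. B z j p k * ((?E p k ** snd z) $ a $ b + (snd z ** ?E p k) $ a $ b - ?E p k $ a $ b))
     = (\<Sum>p\<in>UNIV. \<Sum>k\<in>UNIV. B z j p k * (?E p k ** snd z) $ a $ b)
       + (\<Sum>p\<in>UNIV. \<Sum>k\<in>UNIV. B z j p k * (snd z ** ?E p k) $ a $ b)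
       - (\<Sum>p\<in>UNIV. \<Sum>k\<in>UNIV. B z j p k * ?E p k $ a $ b)"
    by (simp add: algebra_simps sum.distrib sum_subtractf)
  also have "\<dots> = (\<Sum>k\<in>UNIV. B z j a k * snd z $ k $ b) + (\<Sum>p\<in>UNIV. B z j p b * snd z $ a $ p) - B z j a b"
    by (simp only: left right sum_matrix_unit_entry)
  finally show ?thesis using assms by (simp add: first_variation_def)
qed

text \<open>Summed over the free index, each family of identities isolates one piece of
  g(x) h(z)_i + P_ij D_j g(x); here P is a symmetric idempotent matrix.\<close>
lemma sum_first_variation_idempotence_defect:
  assumes idem: "snd z ** snd z = snd z"
  shows "(\<Sum>j\<in>UNIV. first_variation g g' (\<lambda>P. (P ** P) $ i $ j - P $ i $ j)
            (\<lambda>P v. (v ** P) $ i $ j + (P ** v) $ i $ j - v $ i $ j) j z)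
     = g (fst z) * ((\<Sum>j\<in>UNIV. \<Sum>k\<in>UNIV. B z j i k * snd z $ k $ j)
         + (\<Sum>p\<in>UNIV. curvature_trace z p * snd z $ i $ p) - curvature_trace z i)"
proof -
  have "(\<Sum>j\<in>UNIV. first_variation g g' (\<lambda>P. (P ** P) $ i $ j - P $ i $ j)
            (\<lambda>P v. (v ** P) $ i $ j + (P ** v) $ i $ j - v $ i $ j) j z)
     = (\<Sum>j\<in>UNIV. g (fst z) * ((\<Sum>k\<in>UNIV. B z j i k * snd z $ k $ j)
         + (\<Sum>p\<in>UNIV. B z j p j * snd z $ i $ p) - B z j i j))"
    using idem by (intro sum.cong refl) (simp add: first_variation_idempotence_defect)
  also have "\<dots> = g (fst z) * ((\<Sum>j\<in>UNIV. \<Sum>k\<in>UNIV. B z j i k * snd z $ k $ j)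
      + (\<Sum>j\<in>UNIV. \<Sum>p\<in>UNIV. B z j p j * snd z $ i $ p) - (\<Sum>j\<in>UNIV. B z j i j))"
    by (simp add: sum_distrib_left sum.distrib sum_subtractf algebra_simps)
  also have "(\<Sum>j\<in>UNIV. \<Sum>p\<in>UNIV. B z j p j * snd z $ i $ p) = (\<Sum>p\<in>UNIV. curvature_trace z p * snd z $ i $ p)"
    by (subst sum.swap) (simp add: curvature_trace_def sum_distrib_right)
  finally show ?thesis by (simp add: curvature_trace_def)
qed

lemma sum_first_variation_entry:
  assumes sym: "transpose (snd z) = snd z" and idem: "snd z ** snd z = snd z"
  shows "(\<Sum>p\<in>UNIV. first_variation g g' (\<lambda>P. P $ p $ i) (\<lambda>P v. v $ p $ i) p z)
     = (\<Sum>j\<in>UNIV. snd z $ i $ j * g' (fst z) (axis j 1)) + g (fst z) * (\<Sum>p\<in>UNIV. B z p p i)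
       + g (fst z) * (\<Sum>p\<in>UNIV. curvature_trace z p * snd z $ p $ i)"
proof -
  define P where "P = snd z"
  define G where "G j = g' (fst z) (axis j (1::real))" for j
  have P_sym: "P $ a $ b = P $ b $ a" for a b
    using symmetric_entry[OF sym] by (simp add: P_def)
  have "(\<Sum>p\<in>UNIV. (\<Sum>j\<in>UNIV. P $ p $ j * G j) * P $ p $ i)
      = (\<Sum>j\<in>UNIV. \<Sum>p\<in>UNIV. P $ j $ p * P $ p $ i * G j)"
    by (subst sum.swap) (simp add: sum_distrib_right sum_distrib_left mult_ac P_sym)
  also have "\<dots> = (\<Sum>j\<in>UNIV. P $ j $ i * G j)"
    using idempotent_entry[OF idem] by (simp add: P_def sum_distrib_right[symmetric])
  also have "\<dots> = (\<Sum>j\<in>UNIV. P $ i $ j * G j)"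
    by (simp add: P_sym[of _ i])
  finally have tangential: "(\<Sum>p\<in>UNIV. (\<Sum>j\<in>UNIV. P $ p $ j * G j) * P $ p $ i) = (\<Sum>j\<in>UNIV. P $ i $ j * G j)" .
  have "(\<Sum>p\<in>UNIV. first_variation g g' (\<lambda>P. P $ p $ i) (\<lambda>P v. v $ p $ i) p z)
    = (\<Sum>p\<in>UNIV. (\<Sum>j\<in>UNIV. P $ p $ j * G j) * P $ p $ i) + g (fst z) * (\<Sum>p\<in>UNIV. B z p p i)
      + g (fst z) * (\<Sum>p\<in>UNIV. curvature_trace z p * P $ p $ i)"
    by (simp add: first_variation_entry sum.distrib sum_distrib_left mult_ac P_def G_def)
  then show ?thesis using tangential by (simp add: P_def G_def)
qed

lemma sum_first_variation_antisym_entry: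
  assumes sym: "transpose (snd z) = snd z"
  shows "(\<Sum>p\<in>UNIV. first_variation g g' (\<lambda>P. P $ p $ i - P $ i $ p) (\<lambda>P v. v $ p $ i - v $ i $ p) p z)
     = g (fst z) * ((\<Sum>p\<in>UNIV. B z p p i) - curvature_trace z i)"
proof -
  have "(\<Sum>p\<in>UNIV. first_variation g g' (\<lambda>P. P $ p $ i - P $ i $ p) (\<lambda>P v. v $ p $ i - v $ i $ p) p z)
      = (\<Sum>p\<in>UNIV. g (fst z) * (B z p p i - B z p i p))"
    using symmetric_entry[OF sym] by (intro sum.cong refl) (simp add: first_variation_antisym_entry)
  then show ?thesis
    by (simp add: sum_distrib_left sum_subtractf right_diff_distrib curvature_trace_def)
qed

text \<open>The key algebraic identity: for an orthogonal projection P, the integrand of the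
  first variation formula with mean curvature h is a combination of first variations.\<close>
lemma first_variation_combination:
  assumes sym: "transpose (snd z) = snd z" and idem: "snd z ** snd z = snd z"
  shows "(\<Sum>j\<in>UNIV. snd z $ i $ j * g' (fst z) (axis j 1)) + g (fst z) * curvature_vector B z $ i
    = 2 * first_variation g g' (\<lambda>P. 1) (\<lambda>P v. 0) i z
      + (\<Sum>j\<in>UNIV. first_variation g g' (\<lambda>P. (P ** P) $ i $ j - P $ i $ j)
           (\<lambda>P v. (v ** P) $ i $ j + (P ** v) $ i $ j - v $ i $ j) j z)
      - (\<Sum>p\<in>UNIV. first_variation g g' (\<lambda>P. P $ p $ i) (\<lambda>P v. v $ p $ i) p z)
      + (\<Sum>p\<in>UNIV. first_variation g g' (\<lambda>P. P $ p $ i - P $ i $ p) (\<lambda>P v. v $ p $ i - v $ i $ p) p z)"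
proof -
  have "(\<Sum>p\<in>UNIV. curvature_trace z p * snd z $ i $ p) = (\<Sum>p\<in>UNIV. curvature_trace z p * snd z $ p $ i)"
    using symmetric_entry[OF sym] by metis
  then show ?thesis
    unfolding first_variation_const sum_first_variation_idempotence_defect[OF idem]
      sum_first_variation_entry[OF sym idem] sum_first_variation_antisym_entry[OF sym]
    by (simp add: curvature_vector_def algebra_simps)
qed

end

subsection \<open>The curvature vector is a weak mean curvature\<close>

lemma has_bochner_integral_sum_zero:
  fixes F :: "'i \<Rightarrow> 'a \<Rightarrow> 'b::{banach,second_countable_topology}"
  assumes "\<And>i. has_bochner_integral M (F i) 0"
  shows "has_bochner_integral M (\<lambda>x. \<Sum>i\<in>I. F i x) 0"
  using has_bochner_integral_sum[where I=I and f=F and x="\<lambda>_. 0" and M=M] assms by simp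

context curved_varifold
begin

text \<open>Component i of the first variation formula, tested against a single C^1 function g
  with compact support: integrate the pointwise combination of first variations.\<close>
lemma tangential_divergence_identity:
  assumes g: "C1_deriv g g'" and g_supp: "compact (closure {x. g x \<noteq> 0})"
  shows "has_bochner_integral V
    (\<lambda>z. (\<Sum>j\<in>UNIV. snd z $ i $ j * g' (fst z) (axis j 1)) + g (fst z) * curvature_vector B z $ i) 0"
proof -
  note zero = first_variation_has_integral_zero[OF g g_supp]
  let ?R = "\<lambda>z. 2 * first_variation g g' (\<lambda>P. 1) (\<lambda>P v. 0) i z
      + (\<Sum>j\<in>UNIV. first_variation g g' (\<lambda>P. (P ** P) $ i $ j - P $ i $ j)
           (\<lambda>P v. (v ** P) $ i $ j + (P ** v) $ i $ j - v $ i $ j) j z)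
      - (\<Sum>p\<in>UNIV. first_variation g g' (\<lambda>P. P $ p $ i) (\<lambda>P v. v $ p $ i) p z)
      + (\<Sum>p\<in>UNIV. first_variation g g' (\<lambda>P. P $ p $ i - P $ i $ p) (\<lambda>P v. v $ p $ i - v $ i $ p) p z)"
  have "has_bochner_integral V ?R (2 * 0 + 0 - 0 + 0)"
    by (intro has_bochner_integral_add has_bochner_integral_diff has_bochner_integral_mult_right
        has_bochner_integral_sum_zero zero C1_deriv_const C1_deriv_entry C1_deriv_antisym_entry C1_deriv_idempotence_defect)
  then have "has_bochner_integral V ?R 0" by simp
  moreover have "AE z in V. ?R z = (\<Sum>j\<in>UNIV. snd z $ i $ j * g' (fst z) (axis j 1))
      + g (fst z) * curvature_vector B z $ i"
    using ae_projection by (rule eventually_mono) (simp add: first_variation_combination)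
  moreover have "?R \<in> borel_measurable V"
    by (intro borel_measurable_add borel_measurable_diff borel_measurable_sum borel_measurable_times
        borel_measurable_const borel_measurable_integrable first_variation_integrable g C1_deriv_const
        C1_deriv_entry C1_deriv_antisym_entry C1_deriv_idempotence_defect)
  moreover have "(\<lambda>z. (\<Sum>j\<in>UNIV. snd z $ i $ j * g' (fst z) (axis j 1))
      + g (fst z) * curvature_vector B z $ i) \<in> borel_measurable V"
    unfolding curvature_vector_def
    by (simp, intro borel_measurable_add borel_measurable_sum borel_measurable_times curvature_measurable
        continuous_measurable_V continuous_intros C1_deriv_continuous[OF C1_deriv_fst[OF g]]
        C1_deriv_continuous_deriv[OF C1_deriv_fst[OF g], of "(axis _ 1, 0)", simplified])
  ultimately show ?thesis
    using has_bochner_integral_cong_AE by blast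
qed

lemma curvature_vector_integrable: "integrable V (curvature_vector B)"
proof -
  have "integrable V (\<lambda>z. \<Sum>b\<in>Basis. (curvature_vector B z \<bullet> b) *\<^sub>R b)"
  proof (intro Bochner_Integration.integrable_sum integrable_scaleR_left)
    fix b :: "real^'s" assume "b \<in> Basis"
    then obtain i where "b = axis i 1" by (auto simp: Basis_vec_def)
    then show "integrable V (\<lambda>z. curvature_vector B z \<bullet> b)"
      by (simp add: inner_axis curvature_vector_def)
        (intro Bochner_Integration.integrable_sum curvature_times_continuous_integrable continuous_intros)
  qed
  then show ?thesis by (simp add: euclidean_representation)
qed

text \<open>The first step of the proof: h is a weak mean curvature of V in R^S. For a vector field
  X the identity follows by summing the component identities for g = X_i.\<close>
theorem curvature_vector_weak_mean_curvature: "weak_mean_curvature V (curvature_vector B)"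
  unfolding weak_mean_curvature_def
proof (intro conjI allI impI)
  show "loc_integrable V (curvature_vector B)"
    unfolding loc_integrable_def set_integrable_def
  proof (intro allI impI)
    fix K :: "((real^'s) \<times> (real^'s^'s)) set" assume "compact K"
    then have "K \<in> sets V" by (simp add: sets_V borel_closed compact_imp_closed)
    then show "integrable V (\<lambda>z. indicator K z *\<^sub>R curvature_vector B z)"
      by (rule integrable_mult_indicator[OF _ curvature_vector_integrable])
  qed
next
  fix X :: "real^'s \<Rightarrow> real^'s" assume "C1c X"
  then obtain X' where X'_deriv: "\<And>x. (X has_derivative blinfun_apply (X' x)) (at x)"
    and X'_cont: "continuous_on UNIV X'" and X_supp: "compact (closure {x. X x \<noteq> 0})"
    unfolding C1c_def by blast
  have component_C1: "C1_deriv (\<lambda>x. X x $ i) (\<lambda>x v. X' x v $ i)" for i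
    unfolding C1_deriv_def
    by (auto intro!: bounded_linear.has_derivative[OF bounded_linear_vec_nth X'_deriv]
        continuous_intros X'_cont)
  have component_supp: "compact (closure {x. X x $ i \<noteq> 0})" for i
  proof -
    have "closure {x. X x $ i \<noteq> 0} \<subseteq> closure {x. X x \<noteq> 0}"
      by (rule closure_mono) auto
    then show ?thesis
      by (metis X_supp closed_closure compact_Int_closed inf.absorb_iff2)
  qed
  define D where "D z = divP (snd z) X (fst z)" for z
  have D_eq: "D z = (\<Sum>i\<in>UNIV. \<Sum>j\<in>UNIV. snd z $ i $ j * X' (fst z) (axis j 1) $ i)" for z
    using frechet_derivative_at[OF X'_deriv] by (simp add: D_def divP_def)
  have "has_bochner_integral V (\<lambda>z. \<Sum>i\<in>UNIV. (\<Sum>j\<in>UNIV. snd z $ i $ j * X' (fst z) (axis j 1) $ i)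
      + X (fst z) $ i * curvature_vector B z $ i) 0"
    by (intro has_bochner_integral_sum_zero tangential_divergence_identity component_C1 component_supp)
  then have sum_zero: "has_bochner_integral V (\<lambda>z. D z + curvature_vector B z \<bullet> X (fst z)) 0"
    by (simp add: D_eq sum.distrib inner_vec_def mult.commute)
  have "integrable V D"
    unfolding D_eq[abs_def]
    by (intro continuous_integrable continuous_intros continuous_on_compose2[OF X'_cont]) auto
  from has_bochner_integral_diff[OF sum_zero has_bochner_integral_integrable[OF this]]
  have "has_bochner_integral V (\<lambda>z. curvature_vector B z \<bullet> X (fst z)) (- integral\<^sup>L V D)"
    by simp
  then show "integral\<^sup>L V (\<lambda>z. divP (snd z) X (fst z)) = - integral\<^sup>L V (\<lambda>z. curvature_vector B z \<bullet> X (fst z))"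
    by (simp add: has_bochner_integral_iff D_def[abs_def])
qed

end

subsection \<open>The trace of the second fundamental form\<close>

text \<open>The second step: tracing A^i_jj over j and using P^2 = P identifies h_i with the
  tangential correction sum_jk P_jk dQ_ij/dx_k, so the mean curvature relative to Nbar of
  the curvature vector vanishes wherever the second fundamental form does.\<close>
lemma trace_second_fundamental_form:
  fixes z :: "(real^'s::finite) \<times> (real^'s^'s)"
  assumes sff: "\<And>j. second_fundamental_form Q B z i j j = 0"
    and idem: "snd z ** snd z = snd z"
  shows "curvature_vector B z $ i = (\<Sum>j\<in>UNIV. \<Sum>k\<in>UNIV. snd z $ j $ k * dQ Q k (fst z) i j)"
proof -
  let ?P = "snd z" and ?x = "fst z"
  have "curvature_vector B z $ i
      = (\<Sum>j\<in>UNIV. \<Sum>l\<in>UNIV. \<Sum>q\<in>UNIV. ?P $ l $ j * ?P $ j $ q * dQ Q q ?x i l)"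
    unfolding curvature_vector_def vec_lambda_beta
  proof (rule sum.cong[OF refl])
    fix j :: 's
    show "(\<Sum>k\<in>UNIV. B z j i k * ?P $ k $ j) = (\<Sum>l\<in>UNIV. \<Sum>q\<in>UNIV. ?P $ l $ j * ?P $ j $ q * dQ Q q ?x i l)"
      using sff[of j] by (simp add: second_fundamental_form_def mult.commute)
  qed
  also have "\<dots> = (\<Sum>l\<in>UNIV. \<Sum>q\<in>UNIV. \<Sum>j\<in>UNIV. ?P $ l $ j * ?P $ j $ q * dQ Q q ?x i l)"
    by (subst sum.swap, rule sum.cong[OF refl], rule sum.swap)
  also have "\<dots> = (\<Sum>l\<in>UNIV. \<Sum>q\<in>UNIV. ?P $ l $ q * dQ Q q ?x i l)"
    by (simp add: sum_distrib_right[symmetric] idempotent_entry[OF idem])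
  finally show ?thesis .
qed

lemma relative_mean_curvature_of_curvature_vector:
  assumes "\<And>i j. second_fundamental_form Q B z i j j = 0" and "snd z ** snd z = snd z"
  shows "relative_mean_curvature Q (curvature_vector B) z = 0"
  using trace_second_fundamental_form[OF assms] by (simp add: relative_mean_curvature_def vec_eq_iff)

subsection \<open>The theorem\<close>

theorem lemma7p2:
  fixes Nbar N :: "(real^'s) set"
    and Q :: "real^'s \<Rightarrow> real^'s^'s"
    and m :: nat
  assumes "embedded_submanifold TYPE('n::finite) Nbar"
    and "tangent_projection TYPE('n) Nbar Q"
    and "N \<subseteq> Nbar" and "compact N"
    and "1 \<le> m" and "m \<le> CARD('n) - 1"
    and "\<not> (\<exists>V. varifold m N Q V \<and> nonzero_measure V \<and> null_relative_mean_curvature Q V)"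
  shows "\<not> (\<exists>V. varifold m N Q V \<and> nonzero_measure V \<and> null_second_fundamental_form Q V)"
proof
  assume "\<exists>V. varifold m N Q V \<and> nonzero_measure V \<and> null_second_fundamental_form Q V"
  then obtain V B where V: "varifold m N Q V" and nonzero: "nonzero_measure V"
    and B: "generalized_curvature V B"
    and sff: "AE z in V. \<forall>k i j. second_fundamental_form Q B z k i j = 0"
    unfolding null_second_fundamental_form_def by blast
  interpret curved_varifold m N Q V B
    using V \<open>compact N\<close> B by unfold_locales
  have "AE z in V. relative_mean_curvature Q (curvature_vector B) z = 0"
    using ae_projection sff
    by eventually_elim (simp add: relative_mean_curvature_of_curvature_vector)
  with curvature_vector_weak_mean_curvature have "null_relative_mean_curvature Q V"
    unfolding null_relative_mean_curvature_def by blast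
  with V nonzero assms(7) show False by blast
qed

end
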